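(* Let $G=\mathbb{Z}_p\times\mathbb{Z}_p$ for an odd prime $p$, let $S$ be a proper subset of $G\setminus\{0\}$ that generates $G$, and let $S_0=S\cup\{(0,0)\}$. Then a subset $C$ of $G$ is a perfect code in $\mathrm{Cay}(G,S)$ if and only if $|S|=p-1$ and there exist $a,b\in\mathbb{Z}_p$ such that $\{as_1-bs_2\mid (s_1,s_2)\in S_0\}=\mathbb{Z}_p$ and $C=\{(bn+c,an+d)\mid n\in\mathbb{Z}_p\}$ for some $c,d\in\mathbb{Z}_p$.
   Context: Groups are finite abelian, written additively; $\mathbb{Z}_n$ is the group (ring) of integers modulo $n$. For $S\subseteq G\setminus\{0\}$, $\mathrm{Cay}(G,S)$ is the directed graph with vertex set $G$ and an arc from $x$ to $y$ if and only if $y-x\in S$ ($S$ is not assumed to be inverse-closed). A subset $C\subseteq G$ is a perfect code in $\mathrm{Cay}(G,S)$ if the sets $\{c\}\cup\{v:\text{there is an arc from } c \text{ to } v\}$, $c\in C$, form a partition of $G$. *)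

theory Defs
  imports
    "Berlekamp_Zassenhaus.Finite_Field"
    "Graph_Theory.Pair_Digraph"
    "HOL-Computational_Algebra.Group_Closure"
    "HOL-Library.Disjoint_Sets"
    "HOL-Library.Product_Plus"
begin

definition Cay :: "'a::ab_group_add set \<Rightarrow> 'a pair_pre_digraph" where
  "Cay S = \<lparr>pverts = UNIV, parcs = {(x, y). y - x \<in> S}\<rparr>"

definition closed_out_neighbourhood :: "('a, 'b) pre_digraph \<Rightarrow> 'a \<Rightarrow> 'a set" where
  "closed_out_neighbourhood D c = {c} \<union> {v. c \<rightarrow>\<^bsub>D\<^esub> v}"

text \<open>
  The partition is read as one of a family indexed by the codewords: distinct codewords have
  disjoint (not merely distinct) neighbourhoods. With \<open>partition_on\<close> of the set of
  neighbourhoods, two codewords could share the same block.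
\<close>
definition perfect_code :: "('a, 'b) pre_digraph \<Rightarrow> 'a set \<Rightarrow> bool" where
  "perfect_code D C \<longleftrightarrow>
     C \<subseteq> verts D \<and>
     disjoint_family_on (closed_out_neighbourhood D) C \<and>
     (\<Union>c\<in>C. closed_out_neighbourhood D c) = verts D"

end

theory Submission
  imports Defs
begin

text \<open>
  Let \<open>p = CARD('p)\<close> and \<open>S\<^sub>0 = S \<union> {0}\<close>. The closed out-neighbourhood of \<open>c\<close> is the translate
  \<open>c + S\<^sub>0\<close>, so a perfect code is a set \<open>C\<close> for which every group element is uniquely a sum of an
  element of \<open>C\<close> and one of \<open>S\<^sub>0\<close> (\<open>perfect_code_Cay_iff\<close>). Since \<open>|C| |S\<^sub>0| = p\<^sup>2\<close> and \<open>S\<^sub>0\<close> is neither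
  trivial nor everything, both factors have \<open>p\<close> elements. If \<open>C\<close> is a line, a level set of a linear
  functional \<open>f\<close>, then the factorization says exactly that \<open>f\<close> maps \<open>S\<^sub>0\<close> bijectively onto the
  field, which is the condition of the theorem. The substance is therefore that \<open>C\<close> must be a line. By
  \<open>factor_subset_line\<close> one of the two factors is contained in a line, and it cannot be \<open>S\<^sub>0\<close>: a line
  through \<open>0\<close> is a proper subgroup, whereas \<open>S\<close> generates the group.

  This special case of Redei's theorem on factorizations is proved with power sums modulo \<open>p\<close>. For
  a linear functional \<open>f\<close> write \<open>\<alpha>\<^sub>k\<close> and \<open>\<beta>\<^sub>k\<close> for the sums of \<open>f\<^sup>k\<close> over the two factors. The sum of
  \<open>f\<^sup>k\<close> over the whole group vanishes, and expanding it binomially shows that the first nonvanishing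
  \<open>\<alpha>\<^sub>r\<close> and \<open>\<beta>\<^sub>s\<close> satisfy \<open>r + s \<ge> p\<close>; so one factor has \<open>\<alpha>\<^sub>k = 0\<close> for all \<open>k < p / 2\<close>
  (\<open>power_sums_vanish_for_one_factor\<close>). Among the \<open>p\<close> functionals \<open>x + m y\<close>, at least half favour
  the same factor. As a polynomial in \<open>m\<close>, the \<open>k\<close>-th power sum of this factor has degree at most
  \<open>k\<close>, which is less than its number of roots. Hence it is zero, and the low power sums of that factor
  vanish for every linear functional (\<open>power_sums_vanish_in_all_directions\<close>).

  Finally, a family of \<open>p\<close> field elements whose power sums of exponent \<open>k < p / 2\<close> vanish is constant
  or takes every value once (\<open>constant_or_inj_on_if_power_sums_vanish\<close>); this is Redei's lacunary
  polynomial argument. Applied to a functional that agrees on two chosen points of the factor, it says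
  that the functional is constant there, so that the factor lies on a line.
\<close>

section \<open>Perfect codes as factorizations\<close>

lemma closed_out_neighbourhood_Cay:
  "closed_out_neighbourhood (with_proj (Cay S)) c = (+) c ` insert 0 S"
proof -
  have "v \<in> (+) c ` S \<longleftrightarrow> v - c \<in> S" for v
    by (metis add_diff_cancel_left' diff_add_cancel image_iff)
  thus ?thesis
    by (auto simp: closed_out_neighbourhood_def Cay_def)
qed

lemma perfect_code_Cay_iff:
  "perfect_code (with_proj (Cay S)) C \<longleftrightarrow>
     bij_betw (\<lambda>(c, s). c + s) (C \<times> insert 0 S) UNIV"
proof -
  have "inj_on (\<lambda>(c, s). c + s) (C \<times> insert 0 S) \<longleftrightarrow>
        disjoint_family_on (\<lambda>c. (+) c ` insert 0 S) C"
  proof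
    assume inj: "inj_on (\<lambda>(c, s). c + s) (C \<times> insert 0 S)"
    show "disjoint_family_on (\<lambda>c. (+) c ` insert 0 S) C"
      unfolding disjoint_family_on_def
    proof (intro ballI impI equals0I)
      fix c d v assume "c \<in> C" "d \<in> C" "c \<noteq> d"
        and "v \<in> (+) c ` insert 0 S \<inter> (+) d ` insert 0 S"
      then obtain s s' where "s \<in> insert 0 S" "s' \<in> insert 0 S" "v = c + s" "v = d + s'"
        by blast
      thus False
        using inj_onD[OF inj, of "(c, s)" "(d, s')"] \<open>c \<in> C\<close> \<open>d \<in> C\<close> \<open>c \<noteq> d\<close> by simp
    qed
  next
    assume disj: "disjoint_family_on (\<lambda>c. (+) c ` insert 0 S) C"
    show "inj_on (\<lambda>(c, s). c + s) (C \<times> insert 0 S)"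
    proof (rule inj_onI, clarify)
      fix c d s s' assume *: "c \<in> C" "d \<in> C" "s \<in> insert 0 S" "s' \<in> insert 0 S" "c + s = d + s'"
      have "c + s \<in> (+) c ` insert 0 S \<inter> (+) d ` insert 0 S"
        using *(3,4) unfolding *(5)[symmetric] by (metis *(5) IntI imageI)
      hence "c = d"
        using disj *(1,2) unfolding disjoint_family_on_def by blast
      thus "c = d \<and> s = s'"
        using *(5) by simp
    qed
  qed
  moreover have "(\<lambda>(c, s). c + s) ` (C \<times> insert 0 S) = (\<Union>c\<in>C. (+) c ` insert 0 S)"
    by force
  moreover have "verts (with_proj (Cay S)) = UNIV"
    by (simp add: Cay_def)
  ultimately show ?thesis
    unfolding perfect_code_def bij_betw_def closed_out_neighbourhood_Cay by auto
qed

section \<open>Vanishing power sums\<close>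

lemma sum_power_linear_functional_UNIV:
  fixes m :: "'p::prime_card mod_ring"
  shows "(\<Sum>z\<in>UNIV. (fst z + m * snd z) ^ k) = 0"
proof -
  have "(\<Sum>z\<in>UNIV. (fst z + m * snd z) ^ k) =
        (\<Sum>y\<in>UNIV. \<Sum>x\<in>UNIV. (x + m * y) ^ k)"
    by (subst sum.swap)
       (simp add: sum.cartesian_product case_prod_unfold flip: UNIV_Times_UNIV)
  also have "\<dots> = (\<Sum>y\<in>(UNIV :: 'p mod_ring set). \<Sum>x\<in>UNIV. x ^ k)"
    by (intro sum.cong refl sum.reindex_bij_witness[of _ "\<lambda>x. x - m * y" for y]) auto
  also have "\<dots> = 0"
    by simp
  finally show ?thesis .
qed

text \<open>
  If both factors had a nonvanishing power sum of exponent below \<open>p / 2\<close>, take the least such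
  exponents \<open>r\<close> and \<open>s\<close>. In the binomial expansion of the sum of \<open>f\<^bsup>r+s\<^esup>\<close> over the group only the term
  with exponents \<open>r\<close> and \<open>s\<close> survives, and its binomial coefficient is invertible because
  \<open>r + s < p\<close>.
\<close>
lemma power_sums_vanish_for_one_factor:
  fixes f :: "'g::{ab_group_add,finite} \<Rightarrow> 'p::prime_card mod_ring"
  assumes bij: "bij_betw (\<lambda>(a, b). a + b) (A \<times> B) UNIV"
    and add: "\<And>x y. f (x + y) = f x + f y"
    and zero: "\<And>k. (\<Sum>g\<in>UNIV. f g ^ k) = 0"
  shows "(\<forall>k. 2 * k < CARD('p) \<longrightarrow> (\<Sum>a\<in>A. f a ^ k) = 0) \<or>
         (\<forall>k. 2 * k < CARD('p) \<longrightarrow> (\<Sum>b\<in>B. f b ^ k) = 0)"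
proof (rule ccontr)
  define \<alpha> \<beta> where "\<alpha> k = (\<Sum>a\<in>A. f a ^ k)" and "\<beta> k = (\<Sum>b\<in>B. f b ^ k)" for k
  assume "\<not> ?thesis"
  then obtain r' s' where r': "2 * r' < CARD('p)" "\<alpha> r' \<noteq> 0" and s': "2 * s' < CARD('p)" "\<beta> s' \<noteq> 0"
    unfolding \<alpha>_def \<beta>_def by blast
  define r s where "r = (LEAST k. \<alpha> k \<noteq> 0)" and "s = (LEAST k. \<beta> k \<noteq> 0)"
  have r: "\<alpha> r \<noteq> 0" "r \<le> r'" and s: "\<beta> s \<noteq> 0" "s \<le> s'"
    unfolding r_def s_def by (rule LeastI Least_le, fact r'(2) s'(2))+
  have below_r: "\<alpha> i = 0" if "i < r" for i
    using that not_less_Least unfolding r_def by blast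
  have below_s: "\<beta> i = 0" if "i < s" for i
    using that not_less_Least unfolding s_def by blast
  have small: "r + s < CARD('p)"
    using r s r' s' by linarith
  have "0 = (\<Sum>g\<in>UNIV. f g ^ (r + s))"
    by (simp add: zero)
  also have "\<dots> = (\<Sum>(a, b)\<in>A \<times> B. f (a + b) ^ (r + s))"
    using sum.reindex_bij_betw[OF bij, of "\<lambda>g. f g ^ (r + s)"] by (simp add: case_prod_unfold)
  also have "\<dots> = (\<Sum>a\<in>A. \<Sum>b\<in>B. \<Sum>i\<le>r+s. of_nat (r + s choose i) * f a ^ i * f b ^ (r + s - i))"
    by (simp add: add binomial_ring flip: sum.cartesian_product)
  also have "\<dots> = (\<Sum>a\<in>A. \<Sum>i\<le>r+s. \<Sum>b\<in>B. of_nat (r + s choose i) * f a ^ i * f b ^ (r + s - i))"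
    by (intro sum.cong refl sum.swap)
  also have "\<dots> = (\<Sum>i\<le>r+s. \<Sum>a\<in>A. \<Sum>b\<in>B. of_nat (r + s choose i) * f a ^ i * f b ^ (r + s - i))"
    by (rule sum.swap)
  also have "\<dots> = (\<Sum>i\<le>r+s. of_nat (r + s choose i) * \<alpha> i * \<beta> (r + s - i))"
    unfolding \<alpha>_def \<beta>_def mult.assoc sum_product by (simp only: sum_distrib_left)
  also have "\<dots> = (\<Sum>i\<in>{r}. of_nat (r + s choose i) * \<alpha> i * \<beta> (r + s - i))"
  proof (rule sum.mono_neutral_right)
    show "\<forall>i\<in>{..r + s} - {r}. of_nat (r + s choose i) * \<alpha> i * \<beta> (r + s - i) = 0"
    proof
      fix i assume "i \<in> {..r + s} - {r}"
      hence "i < r \<or> r + s - i < s" by auto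
      thus "of_nat (r + s choose i) * \<alpha> i * \<beta> (r + s - i) = 0"
        using below_r below_s by auto
    qed
  qed auto
  finally have "of_nat (r + s choose r) = (0 :: 'p mod_ring)"
    using r s by simp
  hence "CARD('p) dvd (r + s choose r)"
    by (rule of_nat_0_mod_ring_dvd)
  hence "CARD('p) dvd fact (r + s)"
    by (metis binomial_fact_lemma dvd_mult le_add1)
  thus False
    using small prime_card[where 'a = 'p] by (simp add: prime_dvd_fact_iff)
qed

text \<open>
  The \<open>k\<close>-th power sum along \<open>x + m y\<close> is a polynomial in \<open>m\<close> of degree at most \<open>k\<close>, so having more
  than \<open>k\<close> roots forces it to be zero. Its values give the functionals with \<open>u \<noteq> 0\<close> up to scaling, and its
  coefficient of degree \<open>k\<close> gives the remaining direction \<open>u = 0\<close>.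
\<close>
lemma power_sums_vanish_in_all_directions:
  fixes A :: "('a::field \<times> 'a) set"
  assumes zero: "\<And>m. m \<in> M \<Longrightarrow> (\<Sum>z\<in>A. (fst z + m * snd z) ^ k) = 0"
    and "k < card M"
  shows "(\<Sum>z\<in>A. (u * fst z + v * snd z) ^ k) = 0"
proof -
  define q where "q = (\<Sum>z\<in>A. [:fst z, snd z:] ^ k)"
  have poly_q: "poly q m = (\<Sum>z\<in>A. (fst z + m * snd z) ^ k)" for m
    by (simp add: q_def poly_sum)
  have coeff_q: "coeff q k = (\<Sum>z\<in>A. snd z ^ k)"
    by (simp add: q_def coeff_sum coeff_linear_poly_power)
  have "degree ([:x, y:] ^ k) \<le> k" for x y :: 'a
    by (rule order.trans[OF degree_power_le]) simp
  hence "coeff q i = 0" if "i > k" for i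
    using that unfolding q_def coeff_sum
    by (intro sum.neutral ballI coeff_eq_0) (meson le_less_trans)
  hence "degree q \<le> k"
    by (intro degree_le) simp
  have "q = 0"
  proof (rule ccontr)
    assume "q \<noteq> 0"
    have "card M \<le> card {m. poly q m = 0}"
      using zero poly_q poly_roots_finite[OF \<open>q \<noteq> 0\<close>] by (intro card_mono) auto
    also have "\<dots> \<le> degree q"
      using \<open>q \<noteq> 0\<close> by (rule card_poly_roots_bound)
    finally show False
      using \<open>degree q \<le> k\<close> \<open>k < card M\<close> by linarith
  qed
  show ?thesis
  proof (cases "u = 0")
    case True
    thus ?thesis
      using coeff_q \<open>q = 0\<close> by (simp add: power_mult_distrib flip: sum_distrib_left)
  next
    case False
    have "(\<Sum>z\<in>A. (u * fst z + v * snd z) ^ k) = (\<Sum>z\<in>A. (u * (fst z + v / u * snd z)) ^ k)"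
      using False by (simp add: distrib_left)
    also have "\<dots> = u ^ k * poly q (v / u)"
      by (simp add: poly_q power_mult_distrib sum_distrib_left)
    finally show ?thesis
      using \<open>q = 0\<close> by simp
  qed
qed

section \<open>Families with vanishing low power sums\<close>

text \<open>
  By Fermat's little theorem each summand is the indicator function of the point \<open>t a\<close>. The polynomial
  therefore interpolates, modulo \<open>p\<close>, the cardinalities of the fibres of \<open>t\<close>.
\<close>
definition fibre_poly :: "'i set \<Rightarrow> ('i \<Rightarrow> 'p::prime_card mod_ring) \<Rightarrow> 'p mod_ring poly" where
  "fibre_poly A t = (\<Sum>a\<in>A. 1 - [:- t a, 1:] ^ (CARD('p) - 1))"

lemma power_card_minus_one:
  fixes x :: "'p::prime_card mod_ring"
  assumes "x \<noteq> 0"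
  shows "x ^ (CARD('p) - 1) = 1"
proof -
  have "x ^ CARD('p) = x"
    using finite_field_power_card_eq_same[of x] by simp
  moreover have "CARD('p) = Suc (CARD('p) - 1)"
    by simp
  ultimately have "x * x ^ (CARD('p) - 1) = x"
    by (metis power_Suc)
  thus ?thesis
    using assms by simp
qed

lemma poly_fibre_poly:
  fixes t :: "'i \<Rightarrow> 'p::prime_card mod_ring"
  assumes "finite A"
  shows "poly (fibre_poly A t) x = of_nat (card {a \<in> A. t a = x})"
proof -
  have "CARD('p) - 1 \<noteq> 0"
    using nontriv[where 'a = 'p] by simp
  have "poly (fibre_poly A t) x = (\<Sum>a\<in>A. if t a = x then 1 else 0)"
    unfolding fibre_poly_def poly_sum
    using \<open>CARD('p) - 1 \<noteq> 0\<close> power_card_minus_one[of "x - t _"]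
    by (intro sum.cong) (auto simp: zero_power)
  also have "\<dots> = of_nat (card {a \<in> A. t a = x})"
    using assms by (simp add: sum.inter_filter[symmetric])
  finally show ?thesis .
qed

text \<open>
  The coefficient of degree \<open>i\<close> is, up to a factor, the power sum of exponent \<open>p - 1 - i\<close>. Hence the
  vanishing of the low power sums removes the upper half of the coefficients.
\<close>
lemma degree_fibre_poly:
  fixes t :: "'i \<Rightarrow> 'p::prime_card mod_ring"
  assumes card: "card A = CARD('p)"
    and zero: "\<And>k. 2 * k < CARD('p) \<Longrightarrow> (\<Sum>a\<in>A. t a ^ k) = 0"
  shows "2 * degree (fibre_poly A t) + 1 < CARD('p)"
proof -
  have "coeff (fibre_poly A t) i = 0" if i: "CARD('p) \<le> 2 * i + 1" for i
  proof -
    define n where "n = CARD('p) - 1"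
    have coeff_power: "coeff ([:- t a, 1:] ^ n) i = of_nat (n choose i) * (- t a) ^ (n - i)" for a
      by (cases "i \<le> n") (simp_all add: coeff_linear_poly_power coeff_eq_0 degree_linear_power binomial_eq_0)
    have "coeff (fibre_poly A t) i =
          (\<Sum>a\<in>A. coeff 1 i) - (\<Sum>a\<in>A. of_nat (n choose i) * (- t a) ^ (n - i))"
      unfolding fibre_poly_def n_def[symmetric]
      by (simp only: coeff_sum coeff_diff coeff_power sum_subtractf)
    also have "(\<Sum>a\<in>A. coeff 1 i) = (0 :: 'p mod_ring)"
      by (simp add: card)
    also have "(\<Sum>a\<in>A. of_nat (n choose i) * (- t a) ^ (n - i)) =
               of_nat (n choose i) * (- 1) ^ (n - i) * (\<Sum>a\<in>A. t a ^ (n - i))"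
      by (simp add: power_minus[of "t _"] sum_distrib_left mult.assoc)
    also have "(\<Sum>a\<in>A. t a ^ (n - i)) = 0"
      using i nontriv[where 'a = 'p] by (intro zero) (simp add: n_def)
    finally show ?thesis
      by simp
  qed
  hence "degree (fibre_poly A t) = 0 \<or> \<not> CARD('p) \<le> 2 * degree (fibre_poly A t) + 1"
    by (metis degree_0 leading_coeff_0_iff)
  moreover have "1 < CARD('p)"
    by (rule nontriv)
  ultimately show ?thesis
    by auto
qed

text \<open>
  This makes \<open>X\<^sup>p - X\<close> visibly divisible by every \<open>X - s\<close>, with quotient \<open>(X - s)\<^bsup>p-1\<^esup> - 1\<close>, the
  negative of a summand of \<open>fibre_poly\<close>.
\<close>
lemma frobenius_linear_poly:
  fixes s :: "'p::prime_card mod_ring"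
  shows "[:- s, 1:] ^ CARD('p) - [:- s, 1:] = [:0, 1:] ^ CARD('p) - [:0, 1:]"
proof -
  have split: "[:0, 1:] = [:- s, 1:] + [:s:]"
    by simp
  have "[:0, 1:] ^ CARD('p) = [:- s, 1:] ^ CARD('p) + [:s:] ^ CARD('p)"
    unfolding split by (rule freshmans_dream) (simp_all add: prime_card)
  moreover have "[:s:] ^ CARD('p) = [:s:]"
    using finite_field_power_card_eq_same[of s] by (simp add: poly_const_pow)
  ultimately show ?thesis
    by simp
qed

text \<open>
  Let \<open>c\<close> be the fibre polynomial and \<open>h = X\<^sup>p + g\<close> the product of the factors \<open>X - t a\<close>. Logarithmic
  differentiation of \<open>h\<close> gives \<open>(X\<^sup>p - X) g' = - h c\<close>. Because \<open>c\<close> has small degree, so has \<open>g'\<close> and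
  then also \<open>g\<close>, i.e. \<open>h\<close> is lacunary. Replacing \<open>X\<^sup>p\<close> by \<open>h - g\<close> turns the identity into
  \<open>h (g' + c) = (g + X) g'\<close>, whose right-hand side has degree below that of \<open>h\<close>. So both sides are
  zero: \<open>c = - g'\<close>, and either \<open>g' = 0\<close> or \<open>g = - X\<close>.
\<close>
lemma fibre_poly_trivial:
  fixes t :: "'i \<Rightarrow> 'p::prime_card mod_ring"
  assumes card: "card A = CARD('p)"
    and zero: "\<And>k. 2 * k < CARD('p) \<Longrightarrow> (\<Sum>a\<in>A. t a ^ k) = 0"
  shows "fibre_poly A t = 0 \<or> fibre_poly A t = 1"
proof -
  define p where "p = CARD('p)"
  define X :: "'p mod_ring poly" where "X = [:0, 1:]"
  define c where "c = fibre_poly A t"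
  define h where "h = (\<Prod>a\<in>A. [:- t a, 1:])"
  define g where "g = h - X ^ p"
  have finA: "finite A"
    using card by (metis card_ge_0_finite zero_less_card_finite)
  have p: "p > 1" "of_nat p = (0 :: 'p mod_ring)" "CHAR('p mod_ring) = p"
    using nontriv[where 'a = 'p] by (simp_all add: p_def)
  have c: "2 * degree c + 1 < p"
    unfolding c_def p_def using assms by (rule degree_fibre_poly)
  have X_pow: "X ^ n = monom 1 n" for n
    by (simp add: X_def monom_altdef)
  have dh: "degree h = p" "lead_coeff h = 1"
  proof -
    show "degree h = p"
      unfolding h_def using card by (simp add: degree_prod_eq_sum_degree p_def)
    show "lead_coeff h = 1"
      unfolding h_def lead_coeff_prod by simp
  qed
  hence "h \<noteq> 0" by auto
  have dh': "pderiv h = pderiv g"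
    by (simp add: g_def pderiv_diff X_pow pderiv_monom p)

  have key: "(X ^ p - X) * pderiv g = - (h * c)"
  proof -
    have "(X ^ p - X) * pderiv g = (\<Sum>a\<in>A. (X ^ p - X) * (\<Prod>b\<in>A-{a}. [:- t b, 1:]))"
      by (simp add: dh'[symmetric] h_def pderiv_prod sum_distrib_left pderiv_pCons)
    also have "\<dots> = (\<Sum>a\<in>A. ([:- t a, 1:] ^ (p - 1) - 1) * h)"
    proof (rule sum.cong)
      fix a assume "a \<in> A"
      hence "h = [:- t a, 1:] * (\<Prod>b\<in>A-{a}. [:- t b, 1:])"
        unfolding h_def using finA by (rule prod.remove[rotated])
      moreover have "X ^ p - X = ([:- t a, 1:] ^ (p - 1) - 1) * [:- t a, 1:]"
      proof -
        have "X ^ p - X = [:- t a, 1:] ^ Suc (p - 1) - [:- t a, 1:]"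
          using frobenius_linear_poly[of "t a"] p(1) by (simp add: X_def p_def)
        thus ?thesis
          by (simp only: power_Suc2 left_diff_distrib mult_1_left)
      qed
      ultimately show "(X ^ p - X) * (\<Prod>b\<in>A-{a}. [:- t b, 1:]) = ([:- t a, 1:] ^ (p - 1) - 1) * h"
        by (simp only: mult.assoc)
    qed simp
    also have "\<dots> = - (h * c)"
      by (simp add: c_def fibre_poly_def p_def sum_distrib_left sum_negf[symmetric] algebra_simps)
    finally show ?thesis .
  qed

  have degree_pderiv_g: "degree (pderiv g) \<le> degree c"
  proof (cases "pderiv g = 0")
    case False
    have X_less: "degree X < degree (X ^ p)"
      using p by (simp add: X_pow degree_monom_eq) (simp add: X_def)
    hence dX: "degree (X ^ p - X) = p"
      using degree_add_eq_left[of "- X" "X ^ p"] by (simp add: X_pow degree_monom_eq)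
    hence "X ^ p - X \<noteq> 0" using p by auto
    have "c \<noteq> 0"
      using key False \<open>X ^ p - X \<noteq> 0\<close> by auto
    have "p + degree (pderiv g) = degree (- (h * c))"
      using key False \<open>X ^ p - X \<noteq> 0\<close> dX by (metis degree_mult_eq)
    also have "\<dots> = p + degree c"
      using \<open>h \<noteq> 0\<close> \<open>c \<noteq> 0\<close> dh by (simp add: degree_mult_eq)
    finally show ?thesis by simp
  qed simp

  have degree_g: "degree g \<le> degree c + 1"
  proof (rule degree_le, intro allI impI)
    fix i assume i: "degree c + 1 < i"
    \<comment> \<open>Differentiation loses no coefficient of degree below \<open>p\<close>, since the factor \<open>i\<close> is invertible.
      From degree \<open>p\<close> on, \<open>g\<close> has no coefficients because \<open>h\<close> is monic of degree \<open>p\<close>.\<close>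
    show "coeff g i = 0"
    proof (cases "i < p")
      case True
      obtain j where j: "i = Suc j"
        using i by (cases i) auto
      have "coeff (pderiv g) j = 0"
        using i j degree_pderiv_g by (intro coeff_eq_0) linarith
      hence "of_nat i * coeff g i = 0"
        unfolding j coeff_pderiv .
      moreover have "\<not> p dvd i"
        using True j by (metis dvd_imp_le not_less zero_less_Suc)
      hence "of_nat i \<noteq> (0 :: 'p mod_ring)"
        unfolding of_nat_eq_0_iff_char_dvd p(3) .
      ultimately show ?thesis
        unfolding mult_eq_0_iff by blast
    next
      case False
      thus ?thesis
        using dh coeff_eq_0[of h i] by (cases "i = p") (simp_all add: g_def X_pow)
    qed
  qed

  have h_mult: "h * (pderiv g + c) = (g + X) * pderiv g"
  proof -
    have "h * c = - ((X ^ p - X) * pderiv g)"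
      using key by simp
    thus ?thesis
      by (simp add: distrib_left) (simp add: g_def algebra_simps)
  qed
  have "degree ((g + X) * pderiv g) < p"
  proof -
    have "degree (g + X) \<le> degree c + 1"
      using degree_g by (intro degree_add_le) (simp_all add: X_def)
    thus ?thesis
      using degree_mult_le[of "g + X" "pderiv g"] degree_pderiv_g c by linarith
  qed
  hence sum_0: "pderiv g + c = 0"
    using h_mult dh \<open>h \<noteq> 0\<close> by (metis degree_mult_eq le_add1 not_less)
  have c_eq: "c = - pderiv g"
    using minus_unique[OF sum_0] by (rule sym)
  have "g + X = 0 \<or> pderiv g = 0"
    using h_mult sum_0 by simp
  thus ?thesis
  proof
    assume "g + X = 0"
    hence "g = - X" by (rule eq_neg_iff_add_eq_0[THEN iffD2])
    hence "pderiv g = - 1"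
      by (simp add: X_def pderiv_minus pderiv_pCons one_pCons)
    thus ?thesis
      using c_eq by (simp add: c_def)
  next
    assume "pderiv g = 0"
    thus ?thesis
      using c_eq by (simp add: c_def)
  qed
qed

text \<open>
  The fibre cardinalities add up to \<open>p\<close> and are all congruent to \<open>0\<close> or all congruent to \<open>1\<close> modulo
  \<open>p\<close>. In the first case a nonempty fibre already exhausts the family; in the second no fibre is empty,
  so each is a single point.
\<close>
lemma constant_or_inj_on_if_power_sums_vanish:
  fixes t :: "'i \<Rightarrow> 'p::prime_card mod_ring"
  assumes card: "card A = CARD('p)"
    and zero: "\<And>k. 2 * k < CARD('p) \<Longrightarrow> (\<Sum>a\<in>A. t a ^ k) = 0"
  shows "(\<exists>x. \<forall>a\<in>A. t a = x) \<or> inj_on t A"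
proof -
  have finA: "finite A"
    using card by (metis card_ge_0_finite zero_less_card_finite)
  consider "fibre_poly A t = 0" | "fibre_poly A t = 1"
    using fibre_poly_trivial[OF assms] by blast
  thus ?thesis
  proof cases
    case 1
    obtain a where a: "a \<in> A"
      using card by fastforce
    define F where "F = {b \<in> A. t b = t a}"
    have F: "F \<subseteq> A" "a \<in> F"
      using a by (auto simp: F_def)
    have "of_nat (card F) = (0 :: 'p mod_ring)"
      using poly_fibre_poly[OF finA, of t "t a"] 1 by (simp add: F_def)
    hence "CARD('p) dvd card F"
      by (rule of_nat_0_mod_ring_dvd)
    moreover have "card F > 0"
      using F finite_subset[OF F(1) finA] by (auto simp: card_gt_0_iff)
    ultimately have "card A \<le> card F"
      using card by (simp add: dvd_imp_le)
    hence "F = A"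
      using F finA by (metis card_seteq)
    thus ?thesis
      by (auto simp: F_def)
  next
    case 2
    have "x \<in> t ` A" for x
    proof -
      have "of_nat (card {a \<in> A. t a = x}) = (1 :: 'p mod_ring)"
        using poly_fibre_poly[OF finA, of t x] 2 by simp
      hence "{a \<in> A. t a = x} \<noteq> {}"
        by fastforce
      thus ?thesis by blast
    qed
    hence "t ` A = UNIV" by blast
    hence "inj_on t A"
      using card finA by (intro eq_card_imp_inj_on) simp_all
    thus ?thesis ..
  qed
qed

section \<open>One factor is a line\<close>

lemma subset_line_if_power_sums_vanish:
  fixes A :: "('p::prime_card mod_ring \<times> 'p mod_ring) set"
  assumes card: "card A = CARD('p)"
    and zero: "\<And>u v k. 2 * k < CARD('p) \<Longrightarrow> (\<Sum>z\<in>A. (u * fst z + v * snd z) ^ k) = 0"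
  shows "\<exists>a b t. (a, b) \<noteq> (0, 0) \<and> (\<forall>(x, y)\<in>A. a * x - b * y = t)"
proof -
  have "1 < card A"
    using nontriv[where 'a = 'p] by (simp add: card)
  then obtain z w where zw: "z \<in> A" "w \<in> A" "z \<noteq> w"
    by (metis One_nat_def card_le_Suc0_iff_eq card_ge_0_finite less_le_not_le
        order_less_trans zero_less_one)
  \<comment> \<open>The functional that vanishes on the direction of the chord through \<open>z\<close> and \<open>w\<close> is not
    injective on \<open>A\<close>, so it must be constant there.\<close>
  define a b where "a = snd z - snd w" and "b = fst z - fst w"
  define f where "f v = a * fst v + (- b) * snd v" for v
  have ab: "(a, b) \<noteq> (0, 0)"
    using zw by (auto simp: a_def b_def prod_eq_iff)
  have "f z = f w"
    by (simp add: f_def a_def b_def algebra_simps)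
  hence "\<not> inj_on f A"
    using zw by (auto dest: inj_onD)
  then obtain t where "\<forall>v\<in>A. f v = t"
    using constant_or_inj_on_if_power_sums_vanish[OF card, of f] zero
    unfolding f_def by blast
  hence "\<forall>(x, y)\<in>A. a * x - b * y = t"
    by (auto simp: f_def)
  with ab show ?thesis by blast
qed

text \<open>
  Each of the \<open>p\<close> functionals \<open>x + m y\<close> has vanishing low power sums on one of the two factors, so one
  factor serves at least \<open>p / 2\<close> of the values \<open>m\<close>. That is enough roots for every exponent
  \<open>k < p / 2\<close>.
\<close>
theorem factor_subset_line:
  fixes A B :: "('p::prime_card mod_ring \<times> 'p mod_ring) set"
  assumes bij: "bij_betw (\<lambda>(a, b). a + b) (A \<times> B) UNIV"
    and card: "card A = CARD('p)" "card B = CARD('p)"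
  shows "(\<exists>a b t. (a, b) \<noteq> (0, 0) \<and> (\<forall>(x, y)\<in>A. a * x - b * y = t)) \<or>
         (\<exists>a b t. (a, b) \<noteq> (0, 0) \<and> (\<forall>(x, y)\<in>B. a * x - b * y = t))"
proof -
  define M where "M D = {m. \<forall>k. 2 * k < CARD('p) \<longrightarrow> (\<Sum>z\<in>D. (fst z + m * snd z) ^ k) = 0}"
    for D :: "('p mod_ring \<times> 'p mod_ring) set"
  have line: "\<exists>a b t. (a, b) \<noteq> (0, 0) \<and> (\<forall>(x, y)\<in>D. a * x - b * y = t)"
    if D: "card D = CARD('p)" and M: "CARD('p) \<le> 2 * card (M D)" for D
  proof (rule subset_line_if_power_sums_vanish[OF D])
    fix u v k assume k: "2 * k < CARD('p)"
    hence "k < card (M D)"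
      using M by linarith
    thus "(\<Sum>z\<in>D. (u * fst z + v * snd z) ^ k) = 0"
      using k by (intro power_sums_vanish_in_all_directions[where M = "M D"]) (auto simp: M_def)
  qed
  have "M A \<union> M B = UNIV"
  proof -
    have "m \<in> M A \<union> M B" for m
      using power_sums_vanish_for_one_factor[OF bij, of "\<lambda>z. fst z + m * snd z"]
      by (simp add: M_def sum_power_linear_functional_UNIV algebra_simps)
    thus ?thesis by blast
  qed
  hence "CARD('p) \<le> card (M A) + card (M B)"
    using card_Un_le[of "M A" "M B"] by simp
  hence "CARD('p) \<le> 2 * card (M A) \<or> CARD('p) \<le> 2 * card (M B)"
    by linarith
  thus ?thesis
    using line card by blast
qed

lemma card_factor_prime_square:
  fixes A B :: "('p::prime_card mod_ring \<times> 'p mod_ring) set"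
  assumes bij: "bij_betw (\<lambda>(a, b). a + b) (A \<times> B) UNIV"
    and "card B \<noteq> 1" "B \<noteq> UNIV"
  shows "card A = CARD('p)" "card B = CARD('p)"
proof -
  have *: "card A * card B = CARD('p) ^ 2"
    using bij_betw_same_card[OF bij]
    by (simp add: card_cartesian_product power2_eq_square)
  then obtain i where i: "i \<le> 2" "card B = CARD('p) ^ i"
    using prime_card[where 'a = 'p] by (metis divides_primepow_nat dvd_triv_right)
  have "i \<noteq> 0"
    using assms i by (intro notI) simp
  moreover have "i \<noteq> 2"
  proof
    assume "i = 2"
    hence "card B = card (UNIV :: ('p mod_ring \<times> 'p mod_ring) set)"
      using i by (simp add: power2_eq_square)
    thus False
      using \<open>B \<noteq> UNIV\<close> by (simp add: card_eq_UNIV_imp_eq_UNIV)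
  qed
  ultimately have "i = 1"
    using i by linarith
  thus "card B = CARD('p)"
    using i by simp
  thus "card A = CARD('p)"
    using * by (simp add: power2_eq_square)
qed

lemma line_parametrization:
  fixes a b :: "'a::field"
  assumes "(a, b) \<noteq> (0, 0)"
  shows "{(x, y). a * x - b * y = a * c - b * d} = {(b * n + c, a * n + d) | n. n \<in> UNIV}"
proof (intro equalityI subsetI)
  fix z assume "z \<in> {(x, y). a * x - b * y = a * c - b * d}"
  then obtain x y where z: "z = (x, y)" and xy: "a * (x - c) = b * (y - d)"
    by (auto simp: algebra_simps)
  show "z \<in> {(b * n + c, a * n + d) | n. n \<in> UNIV}"
  proof (cases "a = 0")
    case True
    hence "b \<noteq> 0" using assms by simp
    hence "z = (b * ((x - c) / b) + c, a * ((x - c) / b) + d)"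
      using True xy z by simp
    thus ?thesis by blast
  next
    case False
    hence "z = (b * ((y - d) / a) + c, a * ((y - d) / a) + d)"
      using xy z by (simp add: field_simps)
    thus ?thesis by blast
  qed
qed (auto simp: algebra_simps)

lemma card_line:
  fixes a b :: "'p::prime_card mod_ring"
  assumes "(a, b) \<noteq> (0, 0)"
  shows "card {(b * n + c, a * n + d) | n. n \<in> UNIV} = CARD('p)"
proof -
  have "inj (\<lambda>n. (b * n + c, a * n + d))"
    using assms by (auto intro!: injI)
  thus ?thesis
    using card_image[of "\<lambda>n. (b * n + c, a * n + d)" UNIV]
    by (simp add: full_SetCompr_eq)
qed

lemma group_closure_subset_kernel:
  assumes "\<And>x y. f (x - y) = f x - (f y :: 'b::group_add)" and "\<And>x. x \<in> S \<Longrightarrow> f x = 0"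
    and "x \<in> group_closure S"
  shows "f x = 0"
  using assms(3)
proof induction
  case (base s)
  have "f 0 = 0"
    using assms(1)[of 0 0] by simp
  thus ?case
    using base assms(2) by auto
qed (simp add: assms(1))

section \<open>Perfect codes in Cayley digraphs\<close>

theorem theorem3p1:
  fixes S C :: "('p::prime_card mod_ring \<times> 'p mod_ring) set"
  assumes odd_p: "odd CARD('p)"
    and S_proper: "S \<subset> UNIV - {0}"
    and S_generates: "group_closure S = UNIV"
  shows "perfect_code (with_proj (Cay S)) C \<longleftrightarrow>
    card S = CARD('p) - 1 \<and>
    (\<exists>a b :: 'p mod_ring.
       {a * s1 - b * s2 | s1 s2. (s1, s2) \<in> S \<union> {(0, 0)}} = UNIV \<and>
       (\<exists>c d :: 'p mod_ring. C = {(b * n + c, a * n + d) | n. n \<in> UNIV}))"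
    (is "?code \<longleftrightarrow> _")
proof -
  define S0 where "S0 = insert 0 S"
  have S0_eq: "S \<union> {(0, 0)} = S0"
    by (simp add: S0_def zero_prod_def)
  have "0 \<notin> S"
    using S_proper by auto
  hence card_S0: "card S0 = Suc (card S)"
    by (simp add: S0_def)
  define f where "f a b z = a * fst z - b * snd z" for a b and z :: "'p mod_ring \<times> 'p mod_ring"
  have f_add: "f a b (x + y) = f a b x + f a b y"
    and f_diff: "f a b (x - y) = f a b x - f a b y" for a b x y
    by (simp_all add: f_def algebra_simps)
  have f_image: "{a * s1 - b * s2 | s1 s2. (s1, s2) \<in> S0} = f a b ` S0" for a b
    by (force simp: f_def image_def)
  have line: "{(b * n + c, a * n + d) | n. n \<in> UNIV} = {z. f a b z = f a b (c, d)}"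
    if "(a, b) \<noteq> (0, 0)" for a b c d
    unfolding line_parametrization[OF that, symmetric] by (auto simp: f_def)
  have code: "?code \<longleftrightarrow> bij_betw (\<lambda>(c, s). c + s) (C \<times> S0) UNIV"
    by (simp add: perfect_code_Cay_iff S0_def)
  show ?thesis
    unfolding S0_eq f_image
  proof
    assume ?code
    hence bij: "bij_betw (\<lambda>(c, s). c + s) (C \<times> S0) UNIV"
      by (simp add: code)
    have "S \<noteq> {}"
    proof
      assume "S = {}"
      hence "(1, 0) \<in> {0 :: 'p mod_ring \<times> 'p mod_ring}"
        using S_generates by (metis UNIV_I group_closure_empty)
      thus False by (simp add: zero_prod_def)
    qed
    hence "card S0 \<noteq> 1"
      by (simp add: card_S0)
    moreover have "S0 \<noteq> UNIV"
      using S_proper by (auto simp: S0_def)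
    ultimately have card: "card C = CARD('p)" "card S0 = CARD('p)"
      using card_factor_prime_square[OF bij] by blast+
    have "\<not> (\<forall>(x, y)\<in>S0. a * x - b * y = t)" if "(a, b) \<noteq> (0, 0)" for a b t
    proof
      assume *: "\<forall>(x, y)\<in>S0. a * x - b * y = t"
      hence "\<forall>z\<in>S0. f a b z = t"
        by (auto simp: f_def)
      moreover have "f a b 0 = 0"
        by (simp add: f_def)
      ultimately have "f a b z = 0" if "z \<in> S" for z
        using that by (auto simp: S0_def)
      hence "f a b z = 0" for z
        using group_closure_subset_kernel[of "f a b" S z] S_generates f_diff by simp
      from this[of "(1, 0)"] this[of "(0, 1)"] show False
        using that by (simp add: f_def)
    qed
    then obtain a b t where ab: "(a, b) \<noteq> (0, 0)" and t: "\<forall>(x, y)\<in>C. a * x - b * y = t"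
      using factor_subset_line[OF bij card] by blast
    obtain c d where cd: "(c, d) \<in> C"
      using card by (metis card.empty ex_in_conv surj_pair zero_less_card_finite less_irrefl)
    have C: "C = {(b * n + c, a * n + d) | n. n \<in> UNIV}"
    proof (rule card_subset_eq)
      show "C \<subseteq> {(b * n + c, a * n + d) | n. n \<in> UNIV}"
      proof
        fix z assume "z \<in> C"
        hence "f a b z = t" "f a b (c, d) = t"
          using t cd by (auto simp: f_def)
        thus "z \<in> {(b * n + c, a * n + d) | n. n \<in> UNIV}"
          unfolding line[OF ab] by simp
      qed
    qed (simp_all only: card card_line[OF ab] finite)
    \<comment> \<open>On \<open>C\<close> the functional has the constant value \<open>t\<close>, so to reach the value \<open>x\<close> on \<open>S0\<close> it suffices to
      decompose a point where the functional is \<open>x + t\<close>.\<close>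
    have "f a b ` S0 = UNIV"
    proof -
      have "x \<in> f a b ` S0" for x
      proof -
        obtain w where w: "f a b w = x + t"
        proof (cases "a = 0")
          case True
          thus ?thesis using ab that[of "(0, - ((x + t) / b))"] by (simp add: f_def)
        next
          case False
          thus ?thesis using that[of "((x + t) / a, 0)"] by (simp add: f_def)
        qed
        have "w \<in> (\<lambda>(c, s). c + s) ` (C \<times> S0)"
          using bij by (simp add: bij_betw_def)
        then obtain c' s where "c' \<in> C" "s \<in> S0" "w = c' + s"
          by auto
        moreover from \<open>c' \<in> C\<close> have "f a b c' = t"
          using t by (auto simp: f_def)
        ultimately show ?thesis
          using w by (auto simp: f_add)
      qed
      thus ?thesis by blast
    qed
    with C card_S0 card show "card S = CARD('p) - 1 \<and>
      (\<exists>a b. f a b ` S0 = UNIV \<and> (\<exists>c d. C = {(b * n + c, a * n + d) | n. n \<in> UNIV}))"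
      by auto
  next
    assume "card S = CARD('p) - 1 \<and>
      (\<exists>a b. f a b ` S0 = UNIV \<and> (\<exists>c d. C = {(b * n + c, a * n + d) | n. n \<in> UNIV}))"
    then obtain a b c d where card: "card S = CARD('p) - 1" and surj: "f a b ` S0 = UNIV"
      and C: "C = {(b * n + c, a * n + d) | n. n \<in> UNIV}"
      by blast
    have ab: "(a, b) \<noteq> (0, 0)"
    proof
      assume "(a, b) = (0, 0)"
      hence "1 \<notin> f a b ` S0" by (auto simp: f_def)
      thus False using surj by simp
    qed
    hence C: "z \<in> C \<longleftrightarrow> f a b z = f a b (c, d)" for z
      unfolding C line[OF ab] by simp
    \<comment> \<open>As \<open>C\<close> is a full level set of the functional, decomposing a point along \<open>C\<close> and \<open>S0\<close> amounts to
      finding the element of \<open>S0\<close> on which the functional has a prescribed value.\<close>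
    have "inj_on (f a b) S0"
      using card surj by (intro eq_card_imp_inj_on) (simp_all add: card_S0)
    have "inj_on (\<lambda>(c, s). c + s) (C \<times> S0)"
    proof (rule inj_onI, clarify)
      fix x y :: "'p mod_ring \<times> 'p mod_ring" and s s'
      assume *: "x \<in> C" "y \<in> C" "s \<in> S0" "s' \<in> S0" "x + s = y + s'"
      have "f a b x + f a b s = f a b y + f a b s'"
        using *(5) by (simp only: f_add[symmetric])
      hence "f a b s = f a b s'"
        using *(1,2) unfolding C by simp
      hence "s = s'"
        using \<open>inj_on (f a b) S0\<close> *(3,4) by (simp add: inj_on_eq_iff)
      thus "x = y \<and> s = s'"
        using *(5) by simp
    qed
    moreover have "z \<in> (\<lambda>(c, s). c + s) ` (C \<times> S0)" for z
    proof -
      obtain s where s: "s \<in> S0" "f a b s = f a b z - f a b (c, d)"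
        using surj by (metis UNIV_I imageE)
      hence "z - s \<in> C"
        by (simp add: C f_diff)
      thus ?thesis
        using s by (intro image_eqI[of _ _ "(z - s, s)"]) auto
    qed
    ultimately show ?code
      unfolding code bij_betw_def by blast
  qed
qed

end
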